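(* For every vertex $s$ of $G$ we have the equality of formal power series \[\mathcal{R}(G;y)=\frac{\mathcal{P}(G,s;y)}{1-y}.\] In particular, since the left-hand side does not depend on $s$, the polynomial $\mathcal{P}(G,s;y)$ is independent of the choice of $s$.
   Context: Let $G=(V,E)$ be a finite strongly connected digraph (loops and multiple edges allowed). Sinkless sandpile model: a chip configuration is $\mathbf{c}\in\mathbb{N}_0^V$; firing a vertex $v$ removes $\deg^+_G(v)$ chips from $v$ and sends one chip along each outgoing edge; the firing is legal if $\mathbf{c}(v)\ge \deg^+_G(v)$. Write $\mathbf{c}\rightsquigarrow\mathbf{d}$ if $\mathbf{d}$ is obtained from $\mathbf{c}$ by a finite sequence of legal firings. $\mathbf{c}$ is recurrent if it is unstable and $\mathbf{d}\rightsquigarrow\mathbf{c}$ for every $\mathbf{d}$ with $\mathbf{c}\rightsquigarrow\mathbf{d}$. On the set $\mathrm{Rec}(G)$ of recurrent configurations, $\mathbf{c}\sim\mathbf{d}$ iff $\mathbf{c}\rightsquigarrow\mathbf{d}$ (an equivalence relation). The level of a class is the total number of chips $\sum_v \mathbf{c}(v)$; $\mathrm{Rec}_n(G,\sim)$ is the set of classes of level $n$, and $\mathcal{R}(G;y)=\sum_{n\ge0}|\mathrm{Rec}_n(G,\sim)|\,y^n$. Sandpile model with sink $s\in V$: an $s$-configuration is $\widehat{\mathbf{c}}\in\mathbb{N}_0^{V\setminus\{s\}}$; vertices other than $s$ fire as before, chips sent to $s$ are lost, $s$ never fires; every $s$-configuration stabilizes to a unique stable $\widehat{\mathbf{c}}^\circ$.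 $\widehat{\mathbf{c}}$ is $s$-recurrent if for every $s$-configuration $\widehat{\mathbf{c}}_1$ there is $\widehat{\mathbf{c}}_2$ with $(\widehat{\mathbf{c}}_1+\widehat{\mathbf{c}}_2)^\circ=\widehat{\mathbf{c}}$. Let $\mathbf{u}_s(v)$ be the number of edges from $s$ to $v$. On $s$-recurrent configurations, $\widehat{\mathbf{c}}\sim_s\widehat{\mathbf{d}}$ iff $\widehat{\mathbf{d}}=(\widehat{\mathbf{c}}+k\mathbf{u}_s)^\circ$ for some $k\in\mathbb{N}_0$. For an $s$-configuration $\widehat{\mathbf{c}}$, let $\overline{\mathbf{c}}\in\mathbb{N}_0^V$ extend it by $\overline{\mathbf{c}}(s)=0$, and $\mathbf{1}_s$ the indicator of $s$. The $s$-index $\chi(\widehat{\mathbf{c}})$ is the least $k$ with $\overline{\mathbf{c}}+k\mathbf{1}_s$ recurrent in the sinkless model, and the $s$-level is $\mathrm{slvl}(\widehat{\mathbf{c}})=\chi(\widehat{\mathbf{c}})+\sum_{v\ne s}\widehat{\mathbf{c}}(v)$ (constant on $\sim_s$-classes). With $\mathrm{Rec}_n(G,\sim_s)$ the $\sim_s$-classes of $s$-level $n$, $\mathcal{P}(G,s;y)=\sum_{n\ge0}|\mathrm{Rec}_n(G,\sim_s)|\,y^n$ (a polynomial). *)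

theory Defs
  imports
    "Graph_Theory.Digraph_Component"
    "HOL-Computational_Algebra.Polynomial_FPS"
    "HOL-Library.Confluence"
begin

definition arc_mult :: "('a, 'b) pre_digraph \<Rightarrow> 'a \<Rightarrow> 'a \<Rightarrow> nat" where
  "arc_mult G u v = card (out_arcs G u \<inter> in_arcs G v)"

definition fire :: "('a, 'b) pre_digraph \<Rightarrow> 'a \<Rightarrow> ('a \<Rightarrow> nat) \<Rightarrow> ('a \<Rightarrow> nat)" where
  "fire G v c = (\<lambda>w. c w - (if w = v then out_degree G v else 0) + arc_mult G v w)"


section \<open>The sinkless model\<close>

text \<open>
  A chip configuration on the vertex set is a function on the whole vertex type that vanishes
  outside the vertex set, so that distinct functions are distinct configurations.
\<close>

definition configs :: "('a, 'b) pre_digraph \<Rightarrow> ('a \<Rightarrow> nat) set" where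
  "configs G = {c. \<forall>v. v \<notin> verts G \<longrightarrow> c v = 0}"

definition unstable :: "('a, 'b) pre_digraph \<Rightarrow> ('a \<Rightarrow> nat) \<Rightarrow> bool" where
  "unstable G c \<longleftrightarrow> (\<exists>v \<in> verts G. out_degree G v \<le> c v)"

definition legal_firing :: "('a, 'b) pre_digraph \<Rightarrow> ('a \<Rightarrow> nat) \<Rightarrow> ('a \<Rightarrow> nat) \<Rightarrow> bool" where
  "legal_firing G c d \<longleftrightarrow> (\<exists>v \<in> verts G. out_degree G v \<le> c v \<and> d = fire G v c)"

definition leads_to :: "('a, 'b) pre_digraph \<Rightarrow> ('a \<Rightarrow> nat) \<Rightarrow> ('a \<Rightarrow> nat) \<Rightarrow> bool" where
  "leads_to G = (legal_firing G)\<^sup>*\<^sup>*"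

definition recurrent :: "('a, 'b) pre_digraph \<Rightarrow> ('a \<Rightarrow> nat) \<Rightarrow> bool" where
  "recurrent G c \<longleftrightarrow>
     c \<in> configs G \<and> unstable G c \<and> (\<forall>d. leads_to G c d \<longrightarrow> leads_to G d c)"

definition Rec :: "('a, 'b) pre_digraph \<Rightarrow> ('a \<Rightarrow> nat) set" where
  "Rec G = {c. recurrent G c}"

definition rec_rel :: "('a, 'b) pre_digraph \<Rightarrow> (('a \<Rightarrow> nat) \<times> ('a \<Rightarrow> nat)) set" where
  "rec_rel G = {(c, d). c \<in> Rec G \<and> d \<in> Rec G \<and> leads_to G c d}"

definition level :: "('a, 'b) pre_digraph \<Rightarrow> ('a \<Rightarrow> nat) \<Rightarrow> nat" where
  "level G c = (\<Sum>v \<in> verts G. c v)"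

definition rec_classes :: "('a, 'b) pre_digraph \<Rightarrow> nat \<Rightarrow> ('a \<Rightarrow> nat) set set" where
  "rec_classes G n = {C \<in> Rec G // rec_rel G. \<forall>c \<in> C. level G c = n}"

definition rec_series :: "('a, 'b) pre_digraph \<Rightarrow> rat fps" where
  "rec_series G = Abs_fps (\<lambda>n. of_nat (card (rec_classes G n)))"


section \<open>The model with a sink\<close>

text \<open>
  An \<open>s\<close>-configuration is a function that vanishes outside the non-sink vertices. In this
  encoding it coincides with its extension by \<open>0\<close> to the sink \<open>s\<close>.
\<close>

definition sink_configs :: "('a, 'b) pre_digraph \<Rightarrow> 'a \<Rightarrow> ('a \<Rightarrow> nat) set" where
  "sink_configs G s = {c. \<forall>v. v \<notin> verts G - {s} \<longrightarrow> c v = 0}"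

definition sink_stable :: "('a, 'b) pre_digraph \<Rightarrow> 'a \<Rightarrow> ('a \<Rightarrow> nat) \<Rightarrow> bool" where
  "sink_stable G s c \<longleftrightarrow> (\<forall>v \<in> verts G - {s}. c v < out_degree G v)"

text \<open>Resetting the entry at \<open>s\<close> to \<open>0\<close> discards the chips sent to the sink.\<close>

definition sink_firing :: "('a, 'b) pre_digraph \<Rightarrow> 'a \<Rightarrow> ('a \<Rightarrow> nat) \<Rightarrow> ('a \<Rightarrow> nat) \<Rightarrow> bool" where
  "sink_firing G s c d \<longleftrightarrow>
     (\<exists>v \<in> verts G - {s}. out_degree G v \<le> c v \<and> d = (fire G v c)(s := 0))"

definition stabilizes_to :: "('a, 'b) pre_digraph \<Rightarrow> 'a \<Rightarrow> ('a \<Rightarrow> nat) \<Rightarrow> ('a \<Rightarrow> nat) \<Rightarrow> bool" where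
  "stabilizes_to G s c d \<longleftrightarrow> (sink_firing G s)\<^sup>*\<^sup>* c d \<and> sink_stable G s d"

definition stabilization :: "('a, 'b) pre_digraph \<Rightarrow> 'a \<Rightarrow> ('a \<Rightarrow> nat) \<Rightarrow> ('a \<Rightarrow> nat)" where
  "stabilization G s c = (THE d. stabilizes_to G s c d)"

definition sink_recurrent :: "('a, 'b) pre_digraph \<Rightarrow> 'a \<Rightarrow> ('a \<Rightarrow> nat) \<Rightarrow> bool" where
  "sink_recurrent G s c \<longleftrightarrow>
     c \<in> sink_configs G s \<and>
     (\<forall>c1 \<in> sink_configs G s. \<exists>c2 \<in> sink_configs G s.
        stabilization G s (\<lambda>v. c1 v + c2 v) = c)"

definition sink_Rec :: "('a, 'b) pre_digraph \<Rightarrow> 'a \<Rightarrow> ('a \<Rightarrow> nat) set" where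
  "sink_Rec G s = {c. sink_recurrent G s c}"

definition sink_arcs :: "('a, 'b) pre_digraph \<Rightarrow> 'a \<Rightarrow> ('a \<Rightarrow> nat)" where
  "sink_arcs G s = (\<lambda>v. if v = s then 0 else arc_mult G s v)"

definition sink_rel :: "('a, 'b) pre_digraph \<Rightarrow> 'a \<Rightarrow> (('a \<Rightarrow> nat) \<times> ('a \<Rightarrow> nat)) set" where
  "sink_rel G s = {(c, d). c \<in> sink_Rec G s \<and> d \<in> sink_Rec G s \<and>
     (\<exists>k. d = stabilization G s (\<lambda>v. c v + k * sink_arcs G s v))}"

definition sink_index :: "('a, 'b) pre_digraph \<Rightarrow> 'a \<Rightarrow> ('a \<Rightarrow> nat) \<Rightarrow> nat" where
  "sink_index G s c = (LEAST k. recurrent G (\<lambda>v. c v + k * of_bool (v = s)))"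

definition sink_level :: "('a, 'b) pre_digraph \<Rightarrow> 'a \<Rightarrow> ('a \<Rightarrow> nat) \<Rightarrow> nat" where
  "sink_level G s c = sink_index G s c + (\<Sum>v \<in> verts G - {s}. c v)"

definition sink_classes :: "('a, 'b) pre_digraph \<Rightarrow> 'a \<Rightarrow> nat \<Rightarrow> ('a \<Rightarrow> nat) set set" where
  "sink_classes G s n = {C \<in> sink_Rec G s // sink_rel G s. \<forall>c \<in> C. sink_level G s c = n}"

definition sink_series :: "('a, 'b) pre_digraph \<Rightarrow> 'a \<Rightarrow> rat fps" where
  "sink_series G s = Abs_fps (\<lambda>n. of_nat (card (sink_classes G s n)))"


section \<open>Stabilization is well defined and the sink series is a polynomial\<close>

lemma sum_arc_mult:
  fixes f :: "'a \<Rightarrow> nat"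
  assumes "fin_digraph G" and "f s = 0"
  shows "(\<Sum>u \<in> verts G - {s}. arc_mult G v u * f u) = (\<Sum>e \<in> out_arcs G v. f (head G e))"
proof -
  interpret fin_digraph G by fact
  have fin: "finite (out_arcs G v)" by (rule finite_out_arcs)
  have "(\<Sum>u \<in> verts G - {s}. arc_mult G v u * f u) = (\<Sum>u \<in> verts G. arc_mult G v u * f u)"
    using assms(2) by (intro sum.mono_neutral_left) auto
  also have "\<dots> = (\<Sum>u \<in> verts G. \<Sum>e \<in> {e \<in> out_arcs G v. head G e = u}. f (head G e))"
  proof (rule sum.cong)
    fix u
    have "out_arcs G v \<inter> in_arcs G u = {e \<in> out_arcs G v. head G e = u}"
      by (auto simp: out_arcs_def in_arcs_def)
    then show "arc_mult G v u * f u = (\<Sum>e \<in> {e \<in> out_arcs G v. head G e = u}. f (head G e))"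
      by (simp add: arc_mult_def)
  qed simp
  also have "\<dots> = (\<Sum>e \<in> out_arcs G v. f (head G e))"
    using fin by (intro sum.group) (auto simp: out_arcs_def)
  finally show ?thesis .
qed

lemma sink_firing_configs:
  assumes "fin_digraph G" and "c \<in> sink_configs G s" and "sink_firing G s c d"
  shows "d \<in> sink_configs G s"
proof -
  interpret fin_digraph G by fact
  have "arc_mult G v w = 0" if "w \<notin> verts G" for v w
  proof -
    have "out_arcs G v \<inter> in_arcs G w = {}"
      using that by (auto simp: in_arcs_def)
    then show ?thesis by (simp add: arc_mult_def)
  qed
  then show ?thesis
    using assms(2,3) by (auto simp: sink_firing_def sink_configs_def fire_def)
qed

lemma ex_decreasing_weight:
  assumes "fin_digraph G" and "strongly_connected G" and s: "s \<in> verts G"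
  shows "\<exists>w :: 'a \<Rightarrow> nat. w s = 0 \<and>
    (\<forall>v \<in> verts G - {s}. (\<Sum>e \<in> out_arcs G v. w (head G e)) < out_degree G v * w v)"
proof -
  interpret fin_digraph G by fact
  define D where "D v = (LEAST n. (v, s) \<in> arcs_ends G ^^ n)" for v
  have ex: "\<exists>n. (v, s) \<in> arcs_ends G ^^ n" if "v \<in> verts G" for v
  proof -
    have "v \<rightarrow>\<^sup>*\<^bsub>G\<^esub> s" using assms(2) s that by auto
    then have "(v, s) \<in> (arcs_ends G)\<^sup>*" by (rule reachable_rtranclI)
    then show ?thesis by (simp add: rtrancl_power)
  qed
  have Dpow: "(v, s) \<in> arcs_ends G ^^ D v" if "v \<in> verts G" for v
    unfolding D_def using ex[OF that] by (rule LeastI_ex)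
  have Dle: "D v \<le> n" if "(v, s) \<in> arcs_ends G ^^ n" for v n
    unfolding D_def using that by (rule Least_le)
  have Ds: "D s = 0" using Dle[of s 0] by simp
  define N where "N = Max (D ` verts G)"
  define M where "M = Suc (card (arcs G))"
  define p where "p v = M ^ (N - D v)" for v
  have DN: "D v \<le> N" if "v \<in> verts G" for v unfolding N_def using that by simp
  have M: "M \<ge> 1" by (simp add: M_def)
  have pN: "p v \<le> M ^ N" for v unfolding p_def using M by (intro power_increasing) auto
  have "(\<Sum>e \<in> out_arcs G v. M ^ N - p (head G e)) < out_degree G v * (M ^ N - p v)"
    if v: "v \<in> verts G" "v \<noteq> s" for v
  proof -
    have deg: "out_degree G v < M"
      unfolding M_def out_degree_def using card_mono[of "arcs G" "out_arcs G v"]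
      by (simp add: out_arcs_def)
    have "D v \<noteq> 0" using Dpow[OF v(1)] v(2) by (cases "D v") auto
    then obtain m where m: "D v = Suc m" by (cases "D v") auto
    then have "(v, s) \<in> arcs_ends G ^^ Suc m" using Dpow[OF v(1)] by simp
    then obtain u where "(v, u) \<in> arcs_ends G" "(u, s) \<in> arcs_ends G ^^ m"
      by (rule relpow_Suc_E2) blast
    then obtain e where e: "e \<in> out_arcs G v" "D (head G e) \<le> m"
      using Dle by (auto simp: arcs_ends_conv out_arcs_def)
    have "M * p v = M ^ (N - m)"
      using DN[OF v(1)] m by (simp add: p_def Suc_diff_Suc flip: power_Suc)
    also have "\<dots> \<le> p (head G e)"
      unfolding p_def using M e(2) by (intro power_increasing) auto
    also have "\<dots> \<le> (\<Sum>e \<in> out_arcs G v. p (head G e))"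
      using e(1) by (intro member_le_sum) (auto simp: finite_out_arcs)
    finally have 1: "M * p v \<le> (\<Sum>e \<in> out_arcs G v. p (head G e))" .
    have "out_degree G v * p v < M * p v"
      using deg M by (intro mult_strict_right_mono) (auto simp: p_def)
    with 1 have 2: "out_degree G v * p v < (\<Sum>e \<in> out_arcs G v. p (head G e))" by linarith
    have "(\<Sum>e \<in> out_arcs G v. M ^ N - p (head G e)) + (\<Sum>e \<in> out_arcs G v. p (head G e))
        = (\<Sum>e \<in> out_arcs G v. M ^ N)"
      using pN by (simp flip: sum.distrib)
    also have "\<dots> = out_degree G v * (M ^ N - p v) + out_degree G v * p v"
      using pN[of v] by (simp add: out_degree_def flip: distrib_left)
    finally show ?thesis using 2 by linarith
  qed
  moreover have "M ^ N - p s = 0" by (simp add: p_def Ds)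
  ultimately show ?thesis by (intro exI[of _ "\<lambda>v. M ^ N - p v"]) auto
qed

lemma sink_firing_decreases:
  fixes w :: "'a \<Rightarrow> nat"
  assumes "fin_digraph G" and ws: "w s = 0"
    and w: "\<forall>v \<in> verts G - {s}. (\<Sum>e \<in> out_arcs G v. w (head G e)) < out_degree G v * w v"
    and "sink_firing G s c d"
  shows "(\<Sum>v \<in> verts G - {s}. d v * w v) < (\<Sum>v \<in> verts G - {s}. c v * w v)"
proof -
  interpret fin_digraph G by fact
  obtain v where v: "v \<in> verts G - {s}" "out_degree G v \<le> c v" "d = (fire G v c)(s := 0)"
    using assms(4) by (auto simp: sink_firing_def)
  let ?V = "verts G - {s}" and ?r = "\<lambda>u. if u = v then out_degree G v else 0"
  have r: "(\<Sum>u \<in> ?V. ?r u * w u) = out_degree G v * w v"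
  proof -
    have "(\<Sum>u \<in> ?V. ?r u * w u) = (\<Sum>u \<in> ?V. if u = v then out_degree G v * w v else 0)"
      by (intro sum.cong) auto
    then show ?thesis using v(1) by simp
  qed
  have "(\<Sum>u \<in> ?V. d u * w u) + (\<Sum>u \<in> ?V. ?r u * w u)
      = (\<Sum>u \<in> ?V. c u * w u) + (\<Sum>u \<in> ?V. arc_mult G v u * w u)"
    unfolding sum.distrib[symmetric]
  proof (rule sum.cong)
    fix u assume u: "u \<in> ?V"
    have "d u + ?r u = c u + arc_mult G v u" using u v(2,3) by (auto simp: fire_def)
    then have "(d u + ?r u) * w u = (c u + arc_mult G v u) * w u" by simp
    then show "d u * w u + ?r u * w u = c u * w u + arc_mult G v u * w u"
      by (simp only: distrib_right)
  qed simp
  then show ?thesis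
    using bspec[OF w v(1)] r sum_arc_mult[where f = w, OF assms(1) ws, of v] by linarith
qed

lemma ex_stabilizes_to:
  assumes "fin_digraph G" and "strongly_connected G" and "s \<in> verts G"
  shows "\<exists>d. stabilizes_to G s c d"
proof -
  obtain w :: "'a \<Rightarrow> nat" where w: "w s = 0"
    "\<forall>v \<in> verts G - {s}. (\<Sum>e \<in> out_arcs G v. w (head G e)) < out_degree G v * w v"
    using ex_decreasing_weight[OF assms] by blast
  show ?thesis
  proof (induction "\<Sum>v \<in> verts G - {s}. c v * w v" arbitrary: c rule: less_induct)
    case less
    show ?case
    proof (cases "sink_stable G s c")
      case True
      then show ?thesis by (auto simp: stabilizes_to_def)
    next
      case False
      then obtain d where d: "sink_firing G s c d"
        by (auto simp: sink_stable_def sink_firing_def not_less)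
      then obtain d' where "stabilizes_to G s d d'"
        using less sink_firing_decreases[OF assms(1) w d] by blast
      then show ?thesis
        using d unfolding stabilizes_to_def by (meson converse_rtranclp_into_rtranclp)
    qed
  qed
qed

lemma sink_firing_confluent: "confluentp (sink_firing G s)"
proof (rule strong_confluentp_imp_confluentp, rule strong_confluentpI)
  fix c d1 d2 assume "sink_firing G s c d1" "sink_firing G s c d2"
  then obtain u v where
    u: "u \<in> verts G - {s}" "out_degree G u \<le> c u" "d1 = (fire G u c)(s := 0)" and
    v: "v \<in> verts G - {s}" "out_degree G v \<le> c v" "d2 = (fire G v c)(s := 0)"
    by (auto simp: sink_firing_def)
  show "\<exists>d. (sink_firing G s)\<^sup>*\<^sup>* d1 d \<and> (sink_firing G s)\<^sup>=\<^sup>= d2 d"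
  proof (cases "u = v")
    case True
    then show ?thesis using u v by auto
  next
    case False
    have "sink_firing G s d1 ((fire G v d1)(s := 0))"
      unfolding sink_firing_def using u v False by (intro bexI[of _ v]) (simp_all add: fire_def)
    moreover have "sink_firing G s d2 ((fire G u d2)(s := 0))"
      unfolding sink_firing_def using u v False by (intro bexI[of _ u]) (simp_all add: fire_def)
    moreover have "(fire G u d2)(s := 0) = (fire G v d1)(s := 0)"
    proof
      fix x
      show "((fire G u d2)(s := 0)) x = ((fire G v d1)(s := 0)) x"
        using u v False by (cases "x = s"; cases "x = u"; cases "x = v") (simp_all add: fire_def)
    qed
    ultimately show ?thesis by (metis r_into_rtranclp sup2CI)
  qed
qed

lemma stabilizes_to_unique:
  assumes "stabilizes_to G s c d1" and "stabilizes_to G s c d2"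
  shows "d1 = d2"
proof -
  obtain e where e: "(sink_firing G s)\<^sup>*\<^sup>* d1 e" "(sink_firing G s)\<^sup>*\<^sup>* d2 e"
    using assms confluentpD[OF sink_firing_confluent, of G s c d1 d2]
    by (auto simp: stabilizes_to_def)
  have "e = d" if "(sink_firing G s)\<^sup>*\<^sup>* d e" "sink_stable G s d" for d
    using that
    by (cases rule: converse_rtranclpE) (auto simp: sink_firing_def sink_stable_def simp flip: not_less)
  then show ?thesis using e assms by (auto simp: stabilizes_to_def)
qed

lemma stabilizes_to_stabilization:
  assumes "fin_digraph G" and "strongly_connected G" and "s \<in> verts G"
  shows "stabilizes_to G s c (stabilization G s c)"
  unfolding stabilization_def
  using ex_stabilizes_to[OF assms] stabilizes_to_unique by (metis theI)

lemma finite_sink_Rec: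
  assumes "fin_digraph G" and "strongly_connected G" and "s \<in> verts G"
  shows "finite (sink_Rec G s)"
proof -
  interpret fin_digraph G by fact
  let ?F = "{c. \<forall>v. (v \<in> verts G - {s} \<longrightarrow> c v \<in> {..card (arcs G)}) \<and>
    (v \<notin> verts G - {s} \<longrightarrow> c v = 0)}"
  have "c \<in> ?F" if c: "c \<in> sink_Rec G s" for c
  proof -
    have conf: "c \<in> sink_configs G s"
      using c by (simp add: sink_Rec_def sink_recurrent_def)
    then obtain c2 where "stabilization G s (\<lambda>v. c v + c2 v) = c"
      using c unfolding sink_Rec_def sink_recurrent_def by blast
    then have "sink_stable G s c"
      using stabilizes_to_stabilization[OF assms] by (metis stabilizes_to_def)
    moreover have "out_degree G v \<le> card (arcs G)" for v
      unfolding out_degree_def using card_mono[of "arcs G" "out_arcs G v"]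
      by (simp add: out_arcs_def)
    ultimately have "c v \<le> card (arcs G)" if "v \<in> verts G - {s}" for v
      using that unfolding sink_stable_def by (meson less_imp_le order_trans)
    with conf show ?thesis by (auto simp: sink_configs_def)
  qed
  moreover have "finite ?F" by (intro finite_set_of_finite_funs) auto
  ultimately show ?thesis by (meson finite_subset subsetI)
qed

lemma stabilization_stable:
  assumes "fin_digraph G" and "strongly_connected G" and "s \<in> verts G"
    and "sink_stable G s c"
  shows "stabilization G s c = c"
  using stabilizes_to_unique[OF stabilizes_to_stabilization[OF assms(1-3)]] assms(4)
  by (simp add: stabilizes_to_def)

lemma finite_rec_classes:
  assumes "fin_digraph G"
  shows "finite (rec_classes G n)"
proof -
  interpret fin_digraph G by fact
  let ?F = "{c. \<forall>v. (v \<in> verts G \<longrightarrow> c v \<in> {..n}) \<and> (v \<notin> verts G \<longrightarrow> c v = 0)}"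
  have "C \<subseteq> ?F" if C: "C \<in> rec_classes G n" for C
  proof
    fix c assume c: "c \<in> C"
    with C have "c \<in> Rec G" "level G c = n"
      by (auto simp: rec_classes_def rec_rel_def quotient_def)
    moreover have "c v \<le> level G c" if "v \<in> verts G" for v
      unfolding level_def using that by (intro member_le_sum) auto
    ultimately show "c \<in> ?F" by (auto simp: Rec_def recurrent_def configs_def)
  qed
  moreover have "finite ?F" by (intro finite_set_of_finite_funs) auto
  ultimately show ?thesis by (meson PowI finite_Pow_iff finite_subset subsetI)
qed

lemma sink_series_polynomial:
  assumes "fin_digraph G" and "strongly_connected G" and "s \<in> verts G"
  shows "\<exists>p. sink_series G s = fps_of_poly p"
proof -
  have ne: "C \<subseteq> sink_Rec G s \<and> C \<noteq> {}" if C: "C \<in> sink_Rec G s // sink_rel G s" for C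
  proof -
    obtain c where c: "c \<in> sink_Rec G s" "C = sink_rel G s `` {c}"
      using C unfolding quotient_def by blast
    then obtain c2 where "stabilization G s (\<lambda>v. c v + c2 v) = c"
      unfolding sink_Rec_def sink_recurrent_def by blast
    then have "sink_stable G s c"
      using stabilizes_to_stabilization[OF assms] by (metis stabilizes_to_def)
    then have "c = stabilization G s (\<lambda>v. c v + 0 * sink_arcs G s v)"
      using stabilization_stable[OF assms] by simp
    then have "(c, c) \<in> sink_rel G s"
      using c(1) unfolding sink_rel_def by blast
    then show ?thesis using c by (auto simp: sink_rel_def)
  qed
  have "{n. sink_classes G s n \<noteq> {}} \<subseteq> sink_level G s ` sink_Rec G s"
    using ne by (fastforce simp: sink_classes_def)
  then have "finite {n. sink_classes G s n \<noteq> {}}"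
    using finite_sink_Rec[OF assms] by (meson finite_imageI finite_subset)
  then obtain N where N: "\<And>n. sink_classes G s n \<noteq> {} \<Longrightarrow> n \<le> N"
    unfolding finite_nat_set_iff_bounded_le by blast
  have "sink_series G s =
      fps_of_poly (\<Sum>n\<le>N. monom (of_nat (card (sink_classes G s n))) n)"
  proof (rule fps_ext)
    fix n
    have "sink_classes G s n = {}" if "\<not> n \<le> N" using N that by blast
    then show "fps_nth (sink_series G s) n =
        fps_nth (fps_of_poly (\<Sum>n\<le>N. monom (of_nat (card (sink_classes G s n))) n)) n"
      by (cases "n \<le> N") (simp_all add: sink_series_def coeff_sum)
  qed
  then show ?thesis by blast
qed

end

theory Submission
  imports Defs
begin

text \<open>
  A configuration is recurrent iff it lies on a nontrivial cycle of legal firings: in such a cycle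
  every vertex fires, so by the exchange property enough repetitions of it absorb any other legal
  run. Likewise, an \<open>s\<close>-configuration is \<open>s\<close>-recurrent iff it lies on a cycle of the map
  \<open>c \<mapsto> (c + u)\<degree>\<close>, so the classes of \<open>\<sim>\<^sub>s\<close> are these cycles. Forgetting the chips at \<open>s\<close> turns
  sinkless runs into sink runs in which each firing of \<open>s\<close> adds \<open>u\<close>. Since the total number of
  chips is conserved, filling up the sink to level \<open>n\<close> yields a bijection between the
  \<open>\<sim>\<^sub>s\<close>-classes of \<open>s\<close>-level at most \<open>n\<close> and the recurrent classes of level \<open>n\<close>; the coefficients
  of \<open>\<R>\<close> are therefore the partial sums of those of \<open>\<P>\<close>.
\<close>

section \<open>Legal firing runs\<close>

text \<open>Only the number of firings per vertex matters for exchange and balance, so a run records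
  a multiset of vertices and forgets their order.\<close>

inductive firing_run ::
  "('a, 'b) pre_digraph \<Rightarrow> ('a \<Rightarrow> nat) \<Rightarrow> 'a multiset \<Rightarrow> ('a \<Rightarrow> nat) \<Rightarrow> bool" for G where
  empty: "firing_run G c {#} c"
| step: "v \<in> verts G \<Longrightarrow> out_degree G v \<le> c v \<Longrightarrow> firing_run G (fire G v c) M d \<Longrightarrow>
    firing_run G c (add_mset v M) d"

lemma firing_run_trans:
  assumes "firing_run G c M d" and "firing_run G d N e"
  shows "firing_run G c (M + N) e"
  using assms by (induction rule: firing_run.induct) (auto intro: firing_run.intros)

lemma leads_to_iff_firing_run: "leads_to G c d \<longleftrightarrow> (\<exists>M. firing_run G c M d)"
proof
  assume "leads_to G c d"
  then show "\<exists>M. firing_run G c M d"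
    unfolding leads_to_def
    by (induction rule: converse_rtranclp_induct)
      (auto simp: legal_firing_def intro: firing_run.intros)
next
  have "leads_to G c d" if "firing_run G c M d" for M
    using that
  proof (induction rule: firing_run.induct)
    case (step v c M d)
    then have "legal_firing G c (fire G v c)" by (auto simp: legal_firing_def)
    then show ?case
      using step.IH unfolding leads_to_def by (rule converse_rtranclp_into_rtranclp)
  qed (simp add: leads_to_def)
  then show "\<exists>M. firing_run G c M d \<Longrightarrow> leads_to G c d" by blast
qed

lemma leads_to_trans: "leads_to G c d \<Longrightarrow> leads_to G d e \<Longrightarrow> leads_to G c e"
  unfolding leads_to_def by (rule rtranclp_trans)

lemma firing_run_verts: "firing_run G c M d \<Longrightarrow> set_mset M \<subseteq> verts G"
  by (induction rule: firing_run.induct) auto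

lemma fire_add:
  assumes "out_degree G v \<le> c v"
  shows "fire G v (\<lambda>w. c w + y w) = (\<lambda>w. fire G v c w + y w)"
  using assms by (auto simp: fire_def fun_eq_iff)

lemma firing_run_add:
  assumes "firing_run G c M d"
  shows "firing_run G (\<lambda>v. c v + y v) M (\<lambda>v. d v + y v)"
  using assms
proof (induction rule: firing_run.induct)
  case (step v c M d)
  then show ?case by (intro firing_run.step) (auto simp: fire_add)
qed (rule firing_run.empty)

section \<open>Exchange of firings\<close>

lemma fire_commute:
  assumes "v \<noteq> w" and "out_degree G v \<le> c v" and "out_degree G w \<le> c w"
  shows "fire G v (fire G w c) = fire G w (fire G v c)"
  using assms by (auto simp: fire_def fun_eq_iff)

lemma fire_other_ge: "w \<noteq> v \<Longrightarrow> c w \<le> fire G v c w"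
  by (simp add: fire_def)

text \<open>Firing other vertices never takes chips from \<open>v\<close>, so \<open>v\<close> stays
  legal and commutes with them. Hence its first firing in the run can be moved to the front; if
  there is none, \<open>v\<close> can still fire at \<open>d\<close>.\<close>

lemma firing_run_exchange_single:
  assumes "firing_run G c M d" and "v \<in> verts G" and "out_degree G v \<le> c v"
  shows "if v \<in># M then firing_run G (fire G v c) (M - {#v#}) d
    else firing_run G (fire G v c) M (fire G v d)"
  using assms
proof (induction rule: firing_run.induct)
  case (empty c)
  then show ?case by (auto intro: firing_run.empty)
next
  case (step w c M d)
  show ?case
  proof (cases "v = w")
    case True
    with step show ?thesis by simp
  next
    case False
    have v: "out_degree G v \<le> fire G w c v" and w: "out_degree G w \<le> fire G v c w"
      using False step.prems step.hyps fire_other_ge[of v w c G] fire_other_ge[of w v c G] by auto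
    have IH: "if v \<in># M then firing_run G (fire G w (fire G v c)) (M - {#v#}) d
        else firing_run G (fire G w (fire G v c)) M (fire G v d)"
      using step.IH[OF step.prems(1) v] unfolding fire_commute[OF False step.prems(2) step.hyps(2)] .
    show ?thesis
    proof (cases "v \<in># M")
      case True
      then have "firing_run G (fire G v c) (add_mset w (M - {#v#})) d"
        using IH step.hyps w by (intro firing_run.step) auto
      then have "firing_run G (fire G v c) (add_mset w M - {#v#}) d"
        unfolding diff_union_swap[OF False] .
      moreover have "v \<in># add_mset w M" using True by simp
      ultimately show ?thesis by (subst if_P)
    next
      case not_in: False
      then have "firing_run G (fire G v c) (add_mset w M) (fire G v d)"
        using IH step.hyps w by (intro firing_run.step) auto
      then show ?thesis using False not_in by simp
    qed
  qed
qed

text \<open>The firings of \<open>N\<close> are pulled to the front of \<open>M\<close> one after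
  the other; what is left of \<open>M\<close> leads from \<open>e\<close> to
  \<open>d\<close>.\<close>

lemma firing_run_exchange:
  assumes "firing_run G c N e" and "firing_run G c M d" and "N \<subseteq># M"
  shows "firing_run G e (M - N) d"
  using assms
proof (induction arbitrary: M rule: firing_run.induct)
  case (step v c N e)
  then have v: "v \<in># M" by (meson insert_subset_eq_iff)
  then have "firing_run G (fire G v c) (M - {#v#}) d"
    using firing_run_exchange_single[OF step.prems(1) step.hyps(1,2)] by simp
  moreover have "N \<subseteq># M - {#v#}" using step.prems(2) by (simp add: insert_subset_eq_iff)
  ultimately show ?case using step.IH by fastforce
qed simp

section \<open>Balance and conservation of chips\<close>

text \<open>The chips lost by \<open>u\<close> stand on the left and those gained on the right,
  which avoids truncated subtraction.\<close>

lemma firing_run_balance: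
  assumes "firing_run G c M d"
  shows "d u + count M u * out_degree G u = c u + (\<Sum>v \<in># M. arc_mult G v u)"
  using assms
  by (induction rule: firing_run.induct) (auto simp: fire_def split: if_splits)

lemma firing_run_repeat:
  assumes "firing_run G c M c"
  shows "firing_run G c (repeat_mset k M) c"
  using assms by (induction k) (auto intro: firing_run.empty firing_run_trans)

context fin_digraph
begin

lemma sum_arc_mult_verts: "(\<Sum>u \<in> verts G. arc_mult G v u) = out_degree G v"
proof -
  have "out_arcs G v = (\<Union>u \<in> verts G. out_arcs G v \<inter> in_arcs G u)"
    by (auto simp: out_arcs_def in_arcs_def)
  then have "out_degree G v = card (\<Union>u \<in> verts G. out_arcs G v \<inter> in_arcs G u)"
    by (simp add: out_degree_def)
  also have "\<dots> = (\<Sum>u \<in> verts G. card (out_arcs G v \<inter> in_arcs G u))"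
    by (intro card_UN_disjoint) (auto simp: in_arcs_def)
  finally show ?thesis by (simp add: arc_mult_def)
qed

lemma arc_mult_pos: "v \<rightarrow>\<^bsub>G\<^esub> u \<Longrightarrow> 0 < arc_mult G v u"
  by (auto simp: arc_mult_def card_gt_0_iff arcs_ends_conv out_arcs_def in_arcs_def)

lemma fire_configs: "c \<in> configs G \<Longrightarrow> fire G v c \<in> configs G"
  by (auto simp: configs_def fire_def arc_mult_def in_arcs_def card_eq_0_iff)

lemma level_fire:
  assumes "v \<in> verts G" and "out_degree G v \<le> c v"
  shows "level G (fire G v c) = level G c"
proof -
  \<comment> \<open>Adding the removed chips on the left cancels the truncated subtraction in
    \<open>fire\<close>.\<close>
  let ?r = "\<lambda>w. if w = v then out_degree G v else 0"
  have "(\<Sum>w \<in> verts G. fire G v c w + ?r w) = (\<Sum>w \<in> verts G. c w + arc_mult G v w)"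
    using assms(2) by (intro sum.cong) (auto simp: fire_def)
  then show ?thesis
    using assms(1) by (simp add: sum.distrib sum_arc_mult_verts level_def)
qed

lemma leads_to_configs_level:
  assumes "leads_to G c d" and "c \<in> configs G"
  shows "d \<in> configs G" "level G d = level G c"
proof -
  have "d \<in> configs G \<and> level G d = level G c"
    using assms unfolding leads_to_def
    by (induction rule: rtranclp_induct) (auto simp: legal_firing_def level_fire fire_configs)
  then show "d \<in> configs G" "level G d = level G c" by auto
qed

end


section \<open>Recurrence as a cycle\<close>

locale strong_fin_digraph = fin_digraph +
  assumes strong: "strongly_connected G"
begin

text \<open>On a cycle every vertex loses as many chips as it gains. If \<open>v\<close> fires, the
  head of each edge out of \<open>v\<close> gains a chip and so must fire too; strong connectivity
  spreads this to all vertices.\<close>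

lemma firing_cycle_all_verts:
  assumes "firing_run G c M c" and "M \<noteq> {#}" and "v \<in> verts G"
  shows "v \<in># M"
proof -
  obtain u where u: "u \<in># M" using assms(2) by blast
  then have "u \<rightarrow>\<^sup>*\<^bsub>G\<^esub> v"
    using strong assms(3) firing_run_verts[OF assms(1)] by auto
  then have "(u, v) \<in> (arcs_ends G)\<^sup>*" by (rule reachable_rtranclI)
  then show ?thesis
  proof (induction rule: rtrancl_induct)
    case base
    show ?case by (rule u)
  next
    case (step v w)
    have "0 < arc_mult G v w" using step.hyps(2) by (rule arc_mult_pos)
    also have "\<dots> \<le> (\<Sum>v \<in># M. arc_mult G v w)"
      using step.IH by (metis multi_member_split image_mset_add_mset sum_mset.add_mset le_add1)
    finally have "0 < count M w * out_degree G w"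
      using firing_run_balance[OF assms(1), of w] by linarith
    then show ?case by simp
  qed
qed

lemma recurrent_iff_cycle:
  assumes "c \<in> configs G"
  shows "recurrent G c \<longleftrightarrow> (\<exists>M. M \<noteq> {#} \<and> firing_run G c M c)"
proof
  assume rec: "recurrent G c"
  then obtain v where v: "v \<in> verts G" "out_degree G v \<le> c v"
    by (auto simp: recurrent_def unstable_def)
  then have "legal_firing G c (fire G v c)"
    by (auto simp: legal_firing_def)
  then have "leads_to G c (fire G v c)"
    by (simp add: leads_to_def r_into_rtranclp)
  then obtain M where "firing_run G (fire G v c) M c"
    using rec by (auto simp: recurrent_def leads_to_iff_firing_run)
  with v have "firing_run G c (add_mset v M) c" by (rule firing_run.step[of v G c M c])
  then show "\<exists>M. M \<noteq> {#} \<and> firing_run G c M c"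
    by (intro exI[of _ "add_mset v M"]) simp
next
  assume "\<exists>M. M \<noteq> {#} \<and> firing_run G c M c"
  then obtain M where M: "M \<noteq> {#}" "firing_run G c M c" by blast
  from M(2,1) have "unstable G c"
    by (cases rule: firing_run.cases) (auto simp: unstable_def)
  moreover have "leads_to G d c" if cd: "leads_to G c d" for d
  proof -
    obtain N where N: "firing_run G c N d" using cd by (auto simp: leads_to_iff_firing_run)
    \<comment> \<open>In \<open>N\<close> a vertex occurs at most \<open>size N\<close> times, while
      in \<open>M\<close> it occurs at least once.\<close>
    have "N \<subseteq># repeat_mset (size N) M"
    proof (rule mset_subset_eqI)
      fix v
      show "count N v \<le> count (repeat_mset (size N) M) v"
      proof (cases "v \<in># N")
        case True
        then have "v \<in># M"
          using firing_cycle_all_verts[OF M(2,1)] firing_run_verts[OF N] by blast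
        then have "1 \<le> count M v" by (simp add: Suc_le_eq)
        then have "size N \<le> size N * count M v"
          using mult_le_mono2[of 1 "count M v" "size N"] by (simp only: mult_1_right)
        from order_trans[OF count_le_size this] show ?thesis by (simp only: repeat_mset.rep_eq)
      qed (simp add: not_in_iff)
    qed
    then show ?thesis
      using firing_run_exchange[OF N firing_run_repeat[OF M(2)]]
      by (auto simp: leads_to_iff_firing_run)
  qed
  ultimately show "recurrent G c" using assms by (simp add: recurrent_def)
qed

text \<open>A cycle remains legal when further chips lie on the vertices.\<close>

lemma recurrent_add:
  assumes "recurrent G c" and "y \<in> configs G"
  shows "recurrent G (\<lambda>v. c v + y v)"
proof -
  have c: "c \<in> configs G" using assms(1) by (simp add: recurrent_def)
  then obtain M where M: "M \<noteq> {#}" "firing_run G c M c"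
    using assms(1) recurrent_iff_cycle by blast
  have "(\<lambda>v. c v + y v) \<in> configs G" using c assms(2) by (simp add: configs_def)
  then show ?thesis
    using M(1) firing_run_add[OF M(2), of y] recurrent_iff_cycle by blast
qed

lemma recurrent_leads_to:
  assumes "recurrent G c" and "leads_to G c d"
  shows "recurrent G d"
proof -
  obtain M where M: "firing_run G d M c"
    using assms by (auto simp: recurrent_def leads_to_iff_firing_run)
  obtain N where N: "firing_run G c N d"
    using assms by (auto simp: leads_to_iff_firing_run)
  have c: "c \<in> configs G" using assms(1) by (simp add: recurrent_def)
  then obtain K where K: "K \<noteq> {#}" "firing_run G c K c"
    using assms(1) by (auto simp: recurrent_iff_cycle)
  \<comment> \<open>Going around \<open>K\<close> on the way keeps the cycle nonempty even if
    \<open>c = d\<close> and both \<open>M\<close> and \<open>N\<close> are empty.\<close>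
  have "firing_run G d (M + (K + N)) d"
    using M N K by (blast intro: firing_run_trans)
  moreover have "M + (K + N) \<noteq> {#}" using K(1) by simp
  ultimately show ?thesis
    using recurrent_iff_cycle[OF leads_to_configs_level(1)[OF assms(2) c]] by blast
qed

lemma equiv_rec_rel: "equiv (Rec G) (rec_rel G)"
proof (rule equivI)
  show "rec_rel G \<subseteq> Rec G \<times> Rec G" by (auto simp: rec_rel_def)
  show "refl_on (Rec G) (rec_rel G)"
    by (auto simp: refl_on_def rec_rel_def leads_to_def)
  show "sym (rec_rel G)" by (auto simp: sym_def rec_rel_def Rec_def recurrent_def)
  show "trans (rec_rel G)" by (auto simp: trans_def rec_rel_def intro: leads_to_trans)
qed

end


section \<open>Stabilization with a sink\<close>

locale sink_digraph = strong_fin_digraph +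
  fixes s
  assumes sink_in_verts: "s \<in> verts G"
begin

abbreviation sink_leads_to :: "('a \<Rightarrow> nat) \<Rightarrow> ('a \<Rightarrow> nat) \<Rightarrow> bool" where
  "sink_leads_to \<equiv> (sink_firing G s)\<^sup>*\<^sup>*"

abbreviation stab :: "('a \<Rightarrow> nat) \<Rightarrow> ('a \<Rightarrow> nat)" where
  "stab \<equiv> stabilization G s"

abbreviation u :: "'a \<Rightarrow> nat" where
  "u \<equiv> sink_arcs G s"

text \<open>The condition on \<open>y\<close> is due to the entry at the sink, which every sink
  firing resets to 0.\<close>

lemma sink_firing_add:
  assumes "sink_firing G s c d" and "y s = 0"
  shows "sink_firing G s (\<lambda>v. c v + y v) (\<lambda>v. d v + y v)"
proof -
  obtain v where v: "v \<in> verts G - {s}" "out_degree G v \<le> c v" "d = (fire G v c)(s := 0)"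
    using assms(1) by (auto simp: sink_firing_def)
  then have "(\<lambda>v. d v + y v) = (fire G v (\<lambda>v. c v + y v))(s := 0)"
    using assms(2) by (auto simp: fire_add fun_eq_iff)
  then show ?thesis using v unfolding sink_firing_def by (intro bexI[of _ v]) auto
qed

lemma sink_leads_to_add:
  assumes "sink_leads_to c d" and "y s = 0"
  shows "sink_leads_to (\<lambda>v. c v + y v) (\<lambda>v. d v + y v)"
  using assms(1)
proof (induction rule: rtranclp_induct)
  case (step d e)
  then show ?case using sink_firing_add[of d e y, OF step.hyps(2) assms(2)] by simp
qed simp

lemma sink_leads_to_sum:
  assumes "sink_leads_to c d" and "sink_leads_to c' d'" and "c' s = 0" and "d s = 0"
  shows "sink_leads_to (\<lambda>v. c v + c' v) (\<lambda>v. d v + d' v)"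
proof -
  have "sink_leads_to (\<lambda>v. d v + c' v) (\<lambda>v. d v + d' v)"
    using sink_leads_to_add[of c' d' d, OF assms(2,4)] by (simp add: add.commute)
  with sink_leads_to_add[of c d c', OF assms(1,3)] show ?thesis by (rule rtranclp_trans)
qed

lemma sink_leads_to_mult:
  assumes "sink_leads_to c d" and "c s = 0" and "d s = 0"
  shows "sink_leads_to (\<lambda>v. k * c v) (\<lambda>v. k * d v)"
proof (induction k)
  case (Suc k)
  then have "sink_leads_to (\<lambda>v. c v + k * c v) (\<lambda>v. d v + k * d v)"
    using assms by (intro sink_leads_to_sum) auto
  then show ?case by simp
qed simp

lemma sink_leads_to_configs:
  assumes "sink_leads_to c d" and "c \<in> sink_configs G s"
  shows "d \<in> sink_configs G s"
  using assms
  by (induction rule: rtranclp_induct) (auto intro: sink_firing_configs[OF fin_digraph_axioms])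

lemma stab_reach: "sink_leads_to c (stab c)" and stab_stable: "sink_stable G s (stab c)"
  using stabilizes_to_stabilization[OF fin_digraph_axioms strong sink_in_verts, of c]
  by (auto simp: stabilizes_to_def)

lemma stab_configs: "c \<in> sink_configs G s \<Longrightarrow> stab c \<in> sink_configs G s"
  using stab_reach by (rule sink_leads_to_configs)

lemma stab_eqI:
  assumes "sink_leads_to c d" and "sink_stable G s d"
  shows "stab c = d"
  using assms stabilizes_to_unique[of G s c "stab c" d] stab_reach stab_stable
  by (simp add: stabilizes_to_def)

lemma stab_of_stable: "sink_stable G s c \<Longrightarrow> stab c = c"
  by (rule stab_eqI) auto

lemma stab_eq_of_reach: "sink_leads_to c d \<Longrightarrow> stab c = stab d"
  by (rule stab_eqI) (auto intro: rtranclp_trans stab_reach stab_stable)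

text \<open>The abelian property: by uniqueness of the stable result, stabilizing a part first
  changes nothing.\<close>

lemma stab_add: "y s = 0 \<Longrightarrow> stab (\<lambda>v. stab c v + y v) = stab (\<lambda>v. c v + y v)"
  by (rule stab_eq_of_reach[symmetric]) (rule sink_leads_to_add[of _ _ y, OF stab_reach])

lemma u_sink [simp]: "u s = 0"
  by (simp add: sink_arcs_def)

lemma u_configs: "u \<in> sink_configs G s"
  by (auto simp: sink_configs_def sink_arcs_def arc_mult_def in_arcs_def card_eq_0_iff)

lemma stab_add_sink_fires:
  "stab (\<lambda>v. stab (\<lambda>v. c v + j * u v) v + k * u v) = stab (\<lambda>v. c v + (j + k) * u v)"
  using stab_add[of "\<lambda>v. k * u v" "\<lambda>v. c v + j * u v"] by (simp add: algebra_simps)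

lemma stab_cycle_mult:
  assumes "stab (\<lambda>v. c v + k * u v) = c"
  shows "stab (\<lambda>v. c v + (m * k) * u v) = c"
proof (induction m)
  case 0
  \<comment> \<open>For \<open>m = 0\<close> the claim is that \<open>c\<close> is stable, and
    \<open>c\<close> is itself a stabilization by assumption.\<close>
  then show ?case using stab_of_stable[OF stab_stable, of "\<lambda>v. c v + k * u v"] assms by simp
next
  case (Suc m)
  have "stab (\<lambda>v. c v + (k + m * k) * u v) = stab (\<lambda>v. c v + (m * k) * u v)"
    using stab_add_sink_fires[of c k "m * k"] assms by simp
  with Suc show ?case by simp
qed

section \<open>Spreading chips from the sink\<close>

text \<open>A chip is passed along a path from \<open>s\<close> to \<open>v\<close>; at each vertex
  on the way enough copies of the run so far are collected to make that vertex fire.\<close>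

lemma sink_fires_reach_vertex:
  assumes "v \<in> verts G" and "v \<noteq> s"
  shows "\<exists>k d. sink_leads_to (\<lambda>v. k * u v) d \<and> 1 \<le> d v"
proof -
  have "s \<rightarrow>\<^sup>*\<^bsub>G\<^esub> v" using strong assms(1) sink_in_verts by auto
  then have "(s, v) \<in> (arcs_ends G)\<^sup>*" by (rule reachable_rtranclI)
  \<comment> \<open>The first alternative starts the induction: \<open>s\<close> itself never holds
    a chip here.\<close>
  then have "v = s \<or> (\<exists>k d. sink_leads_to (\<lambda>v. k * u v) d \<and> 1 \<le> d v)"
  proof (induction rule: rtrancl_induct)
    case (step v w)
    have pos: "0 < arc_mult G v w" using step.hyps(2) by (rule arc_mult_pos)
    show ?case
    proof (cases "w = s")
      case w: False
      show ?thesis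
      proof (cases "v = s")
        case True
        then have "1 \<le> 1 * u w" using pos w by (simp add: sink_arcs_def)
        moreover have "sink_leads_to (\<lambda>v. 1 * u v) (\<lambda>v. 1 * u v)" by simp
        ultimately show ?thesis by blast
      next
        case v: False
        with step.IH obtain k d where kd: "sink_leads_to (\<lambda>v. k * u v) d" "1 \<le> d v" by blast
        have "(\<lambda>v. k * u v) \<in> sink_configs G s" using u_configs by (simp add: sink_configs_def)
        with kd(1) have "d \<in> sink_configs G s" by (rule sink_leads_to_configs)
        then have "d s = 0" by (simp add: sink_configs_def)
        \<comment> \<open>As \<open>d v\<close> is at least 1, this many copies of the run make
          \<open>v\<close> legal.\<close>
        define m where "m = out_degree G v"
        let ?e = "(fire G v (\<lambda>v. m * d v))(s := 0)"
        have "sink_leads_to (\<lambda>v. (m * k) * u v) (\<lambda>v. m * d v)"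
          using sink_leads_to_mult[of "\<lambda>v. k * u v" d m, OF kd(1)] \<open>d s = 0\<close> by (simp add: mult.assoc)
        moreover have "sink_firing G s (\<lambda>v. m * d v) ?e"
          unfolding sink_firing_def
          using v kd(2) step.hyps(2) by (intro bexI[of _ v]) (auto simp: m_def)
        ultimately have "sink_leads_to (\<lambda>v. (m * k) * u v) ?e"
          by (simp add: rtranclp.rtrancl_into_rtrancl)
        moreover have "1 \<le> ?e w" using pos w by (simp add: fire_def)
        ultimately show ?thesis by blast
      qed
    qed simp
  qed simp
  with assms(2) show ?thesis by blast
qed

text \<open>The vertices are served one by one, each by sufficiently many copies of a run that
  brings a chip to it; runs add up.\<close>

lemma sink_fires_dominate:
  assumes "c \<in> sink_configs G s"
  shows "\<exists>k d. sink_leads_to (\<lambda>v. k * u v) d \<and> (\<forall>v. c v \<le> d v)"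
proof -
  have "\<exists>k d. sink_leads_to (\<lambda>v. k * u v) d \<and> (\<forall>v\<in>F. c v \<le> d v)"
    if "finite F" "F \<subseteq> verts G - {s}" for F
    using that
  proof (induction rule: finite_induct)
    case (insert w F)
    have conf: "d s = 0" if "sink_leads_to (\<lambda>v. k * u v) d" for k d
      using sink_leads_to_configs[OF that] u_configs by (simp add: sink_configs_def)
    obtain k d where kd: "sink_leads_to (\<lambda>v. k * u v) d" "\<forall>v\<in>F. c v \<le> d v"
      using insert by blast
    obtain l e where le: "sink_leads_to (\<lambda>v. l * u v) e" "1 \<le> e w"
      using sink_fires_reach_vertex[of w] insert.prems by blast
    have "sink_leads_to (\<lambda>v. c w * (l * u v)) (\<lambda>v. c w * e v)"
      using sink_leads_to_mult[of "\<lambda>v. l * u v" e "c w", OF le(1)] conf[OF le(1)] by simp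
    from sink_leads_to_sum[OF kd(1) this] conf[OF kd(1)]
    have "sink_leads_to (\<lambda>v. (k + c w * l) * u v) (\<lambda>v. d v + c w * e v)"
      by (simp add: algebra_simps)
    moreover have "c w \<le> c w * e w" using le(2) by simp
    then have "\<forall>v\<in>insert w F. c v \<le> d v + c w * e v"
      using kd(2) by (auto intro: trans_le_add1 trans_le_add2)
    ultimately show ?case by blast
  qed auto
  from this[of "verts G - {s}"] obtain k d
    where "sink_leads_to (\<lambda>v. k * u v) d" "\<forall>v\<in>verts G - {s}. c v \<le> d v" by auto
  moreover have "c v = 0" if "v \<notin> verts G - {s}" for v
    using assms that by (simp add: sink_configs_def)
  ultimately show ?thesis by (metis zero_le)
qed

lemma finite_stable_sink_configs: "finite {c \<in> sink_configs G s. sink_stable G s c}"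
proof -
  have deg: "out_degree G v \<le> card (arcs G)" for v
    unfolding out_degree_def by (intro card_mono) auto
  have "c v \<le> card (arcs G)" if "sink_stable G s c" "v \<in> verts G - {s}" for c v
    using that deg[of v] unfolding sink_stable_def by (meson less_imp_le order_trans)
  then have "{c \<in> sink_configs G s. sink_stable G s c} \<subseteq>
      {c. \<forall>v. (v \<in> verts G - {s} \<longrightarrow> c v \<in> {..card (arcs G)}) \<and> (v \<notin> verts G - {s} \<longrightarrow> c v = 0)}"
    by (auto simp: sink_configs_def)
  moreover have "finite \<dots>" by (intro finite_set_of_finite_funs) auto
  ultimately show ?thesis by (rule finite_subset)
qed

section \<open>Cycles of adding \<open>u\<close> and stabilizing\<close>

text \<open>Pigeonhole on the finitely many stable configurations.\<close>

lemma ex_stab_sink_fires_period: "\<exists>i k. 0 < k \<and> stab (\<lambda>v. (i + k) * u v) = stab (\<lambda>v. i * u v)"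
proof -
  let ?f = "\<lambda>i::nat. stab (\<lambda>v. i * u v)"
  have "?f i \<in> {c \<in> sink_configs G s. sink_stable G s c}" for i
    using u_configs stab_configs[of "\<lambda>v. i * u v"] stab_stable by (auto simp: sink_configs_def)
  then have "finite (range ?f)"
    by (intro finite_subset[OF _ finite_stable_sink_configs]) blast
  then have "\<not> inj ?f" using finite_imageD by blast
  then obtain i j where "i < j" "?f i = ?f j" unfolding inj_def by (metis linorder_neqE_nat)
  then show ?thesis by (intro exI[of _ i] exI[of _ "j - i"]) simp
qed

text \<open>
  Running a cycle often enough sends in so many chips along \<open>u\<close> that
  they can be moved to dominate any prescribed configuration.
\<close>

lemma sink_Rec_iff_cycle:
  "c \<in> sink_Rec G s \<longleftrightarrow>
    c \<in> sink_configs G s \<and> (\<exists>k>0. stab (\<lambda>v. c v + k * u v) = c)"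
proof (intro iffI conjI)
  assume rec: "c \<in> sink_Rec G s"
  then show "c \<in> sink_configs G s" by (simp add: sink_Rec_def sink_recurrent_def)
  obtain i k where ik: "0 < k" "stab (\<lambda>v. (i + k) * u v) = stab (\<lambda>v. i * u v)"
    using ex_stab_sink_fires_period by blast
  have "(\<lambda>v. i * u v) \<in> sink_configs G s" using u_configs by (simp add: sink_configs_def)
  \<comment> \<open>Completing \<open>i * u\<close> to something that stabilizes to \<open>c\<close>
    transfers the period \<open>k\<close> from the multiples of \<open>u\<close> to
    \<open>c\<close>.\<close>
  with rec obtain x where x: "x \<in> sink_configs G s" "stab (\<lambda>v. i * u v + x v) = c"
    by (auto simp: sink_Rec_def sink_recurrent_def)
  have xs: "x s = 0" using x(1) by (simp add: sink_configs_def)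
  have "stab (\<lambda>v. c v + k * u v) = stab (\<lambda>v. stab (\<lambda>v. i * u v + x v) v + k * u v)"
    using x(2) by simp
  also have "\<dots> = stab (\<lambda>v. (i + k) * u v + x v)"
    using stab_add[of "\<lambda>v. k * u v" "\<lambda>v. i * u v + x v"] by (simp add: algebra_simps)
  also have "\<dots> = stab (\<lambda>v. stab (\<lambda>v. i * u v) v + x v)"
    using stab_add[of x, OF xs, of "\<lambda>v. (i + k) * u v"] ik(2) by simp
  also have "\<dots> = c" using stab_add[of x, OF xs] x(2) by simp
  finally show "\<exists>k>0. stab (\<lambda>v. c v + k * u v) = c" using ik(1) by blast
next
  assume "c \<in> sink_configs G s \<and> (\<exists>k>0. stab (\<lambda>v. c v + k * u v) = c)"
  then obtain k where c: "c \<in> sink_configs G s" and k: "0 < k" "stab (\<lambda>v. c v + k * u v) = c"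
    by blast
  have "\<exists>c2 \<in> sink_configs G s. stab (\<lambda>v. c1 v + c2 v) = c" if c1: "c1 \<in> sink_configs G s" for c1
  proof -
    obtain m d where md: "sink_leads_to (\<lambda>v. m * u v) d" "\<forall>v. c1 v \<le> d v"
      using sink_fires_dominate[OF c1] by blast
    \<comment> \<open>Of the \<open>m * k\<close> copies of \<open>u\<close> in \<open>m\<close>
      rounds of the cycle, \<open>m\<close> are turned into \<open>d\<close>, which covers
      \<open>c1\<close>; \<open>?y\<close> holds the other copies together with
      \<open>c\<close>.\<close>
    let ?y = "\<lambda>v. c v + (m * k - m) * u v"
    have y: "?y \<in> sink_configs G s" using c u_configs by (simp add: sink_configs_def)
    have "m \<le> m * k" using k(1) by simp
    then have "m * u v + ?y v = c v + (m * k) * u v" for v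
      by (simp flip: add.assoc distrib_right)
    then have "stab (\<lambda>v. m * u v + ?y v) = c"
      using stab_cycle_mult[OF k(2), of m] by presburger
    moreover have "sink_leads_to (\<lambda>v. m * u v + ?y v) (\<lambda>v. d v + ?y v)"
      using md(1) y by (intro sink_leads_to_add) (auto simp: sink_configs_def)
    ultimately have "stab (\<lambda>v. d v + ?y v) = c" using stab_eq_of_reach by metis
    moreover have "d \<in> sink_configs G s"
      using md(1) by (rule sink_leads_to_configs) (use u_configs in \<open>simp add: sink_configs_def\<close>)
    then have "(\<lambda>v. (d v - c1 v) + ?y v) \<in> sink_configs G s"
      using y by (simp add: sink_configs_def)
    moreover have "c1 v + ((d v - c1 v) + ?y v) = d v + ?y v" for v
      using spec[OF md(2), of v] by linarith
    ultimately show ?thesis by (intro bexI[of _ "\<lambda>v. (d v - c1 v) + ?y v"]) presburger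
  qed
  with c show "c \<in> sink_Rec G s" by (simp add: sink_Rec_def sink_recurrent_def)
qed

lemma sink_RecD:
  assumes "c \<in> sink_Rec G s"
  shows "c \<in> sink_configs G s" "c s = 0" "sink_stable G s c"
proof -
  obtain k where k: "c \<in> sink_configs G s" "stab (\<lambda>v. c v + k * u v) = c"
    using assms sink_Rec_iff_cycle by blast
  then show "c \<in> sink_configs G s" "c s = 0" by (auto simp: sink_configs_def)
  show "sink_stable G s c" using stab_stable k(2) by metis
qed

lemma equiv_sink_rel: "equiv (sink_Rec G s) (sink_rel G s)"
proof (rule equivI)
  show "sink_rel G s \<subseteq> sink_Rec G s \<times> sink_Rec G s" by (auto simp: sink_rel_def)
  show "refl_on (sink_Rec G s) (sink_rel G s)"
  proof (rule refl_onI)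
    fix c assume c: "c \<in> sink_Rec G s"
    then have "c = stab (\<lambda>v. c v + 0 * u v)" using stab_of_stable sink_RecD(3) by simp
    with c show "(c, c) \<in> sink_rel G s" unfolding sink_rel_def by blast
  qed
  show "sym (sink_rel G s)"
  proof (rule symI)
    fix c d assume "(c, d) \<in> sink_rel G s"
    then obtain j where c: "c \<in> sink_Rec G s" and d: "d \<in> sink_Rec G s"
      and j: "d = stab (\<lambda>v. c v + j * u v)" by (auto simp: sink_rel_def)
    obtain k where k: "0 < k" "stab (\<lambda>v. c v + k * u v) = c" using c sink_Rec_iff_cycle by blast
    \<comment> \<open>After \<open>j\<close> steps on a cycle of length \<open>k\<close>, another
      \<open>j * k - j\<close> steps complete \<open>j\<close> rounds.\<close>
    have "stab (\<lambda>v. d v + (j * k - j) * u v) = stab (\<lambda>v. c v + (j * k) * u v)"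
      using stab_add_sink_fires[of c j "j * k - j"] j k(1) by simp
    also have "\<dots> = c" using k(2) by (rule stab_cycle_mult)
    finally show "(d, c) \<in> sink_rel G s" using c d unfolding sink_rel_def by fastforce
  qed
  show "trans (sink_rel G s)"
  proof (rule transI)
    fix c d e assume "(c, d) \<in> sink_rel G s" "(d, e) \<in> sink_rel G s"
    then obtain j k where "c \<in> sink_Rec G s" "e \<in> sink_Rec G s"
      and "d = stab (\<lambda>v. c v + j * u v)" "e = stab (\<lambda>v. d v + k * u v)"
      by (auto simp: sink_rel_def)
    then show "(c, e) \<in> sink_rel G s"
      using stab_add_sink_fires[of c j k] unfolding sink_rel_def by blast
  qed
qed

end


section \<open>Comparing the two models\<close>

context sink_digraph
begin

section \<open>Translating runs between the models\<close>

text \<open>A firing of \<open>s\<close> appears only as an addition of \<open>u\<close>. All these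
  additions may be made at the start, since extra chips do not hinder later sink firings.\<close>

lemma firing_run_project:
  assumes "firing_run G c M d"
  shows "sink_leads_to (\<lambda>v. (c(s := 0)) v + count M s * u v) (d(s := 0))"
  using assms
proof (induction rule: firing_run.induct)
  case (empty c)
  have "(\<lambda>v. (c(s := 0)) v + count {#} s * u v) = c(s := 0)" by (simp add: fun_eq_iff)
  then show ?case by simp
next
  case (step v c M d)
  let ?k = "count M s"
  show ?case
  proof (cases "v = s")
    case True
    have "(\<lambda>w. (c(s := 0)) w + count (add_mset v M) s * u w) =
        (\<lambda>w. ((fire G v c)(s := 0)) w + ?k * u w)"
      using True by (auto simp: fun_eq_iff fire_def sink_arcs_def)
    with step.IH show ?thesis by simp
  next
    case False
    have "(fire G v (c(s := 0)))(s := 0) = (fire G v c)(s := 0)"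
      by (auto simp: fun_eq_iff fire_def)
    then have "sink_firing G s (c(s := 0)) ((fire G v c)(s := 0))"
      unfolding sink_firing_def using step.hyps False by (intro bexI[of _ v]) auto
    then have "sink_firing G s (\<lambda>w. (c(s := 0)) w + ?k * u w)
        (\<lambda>w. ((fire G v c)(s := 0)) w + ?k * u w)"
      by (rule sink_firing_add) simp
    with step.IH False show ?thesis
      by (simp add: converse_rtranclp_into_rtranclp)
  qed
qed

text \<open>The same vertices fire in the same order, with chips piling up at \<open>s\<close>;
  legality at the other vertices does not depend on the chips at \<open>s\<close>.\<close>

lemma leads_to_lift:
  assumes "sink_leads_to (c(s := 0)) d"
  shows "\<exists>e. leads_to G c e \<and> e(s := 0) = d"
  using assms
proof (induction rule: rtranclp_induct)
  case base
  show ?case by (intro exI[of _ c]) (simp add: leads_to_def)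
next
  case (step d d')
  then obtain e where e: "leads_to G c e" "e(s := 0) = d" by blast
  obtain v where v: "v \<in> verts G - {s}" "out_degree G v \<le> d v" "d' = (fire G v d)(s := 0)"
    using step.hyps(2) by (auto simp: sink_firing_def)
  have "out_degree G v \<le> e v" using v(1,2) e(2) by auto
  then have "legal_firing G e (fire G v e)" using v(1) by (auto simp: legal_firing_def)
  with e(1) have "leads_to G c (fire G v e)"
    by (simp add: leads_to_def rtranclp.rtrancl_into_rtrancl)
  moreover have "(fire G v e)(s := 0) = d'" unfolding v(3) e(2)[symmetric] by (auto simp: fun_eq_iff fire_def)
  ultimately show ?case by blast
qed

lemma recurrent_lift_stab_sink_fires:
  assumes "recurrent G c" and "sink_stable G s (c(s := 0))"
  shows "\<exists>d. leads_to G c d \<and> d(s := 0) = stab (\<lambda>v. (c(s := 0)) v + j * u v)"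
proof (induction j)
  case 0
  have "(\<lambda>v. (c(s := 0)) v + 0 * u v) = c(s := 0)" by (simp add: fun_eq_iff)
  then have "stab (\<lambda>v. (c(s := 0)) v + 0 * u v) = c(s := 0)"
    using stab_of_stable[OF assms(2)] by simp
  then show ?case by (intro exI[of _ c]) (simp add: leads_to_def)
next
  case (Suc j)
  then obtain d where d: "leads_to G c d"
    "d(s := 0) = stab (\<lambda>v. (c(s := 0)) v + j * u v)" by blast
  \<comment> \<open>Recurrence guarantees some legal vertex, and all vertices except
    \<open>s\<close> are stable, so \<open>s\<close> itself can fire.\<close>
  have "unstable G d" using recurrent_leads_to[OF assms(1) d(1)] by (simp add: recurrent_def)
  moreover have "sink_stable G s (d(s := 0))" using d(2) stab_stable by simp
  ultimately have "out_degree G s \<le> d s"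
    by (force simp: unstable_def sink_stable_def not_less)
  then have "legal_firing G d (fire G s d)"
    using sink_in_verts by (auto simp: legal_firing_def)
  with d(1) have 1: "leads_to G c (fire G s d)"
    by (simp add: leads_to_def rtranclp.rtrancl_into_rtrancl)
  have "(fire G s d)(s := 0) = (\<lambda>v. (d(s := 0)) v + 1 * u v)"
    by (auto simp: fun_eq_iff fire_def sink_arcs_def)
  then have "stab ((fire G s d)(s := 0)) = stab (\<lambda>v. (c(s := 0)) v + (j + 1) * u v)"
    using stab_add_sink_fires[of "c(s := 0)" j 1] d(2) by simp
  moreover obtain e where "leads_to G (fire G s d) e" "e(s := 0) = stab ((fire G s d)(s := 0))"
    using leads_to_lift[OF stab_reach] by blast
  ultimately show ?case
    using leads_to_trans[OF 1] unfolding Suc_eq_plus1 by metis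
qed

text \<open>A sinkless cycle through \<open>c\<close> fires \<open>s\<close> at least once; its
  projection is a cycle of adding \<open>u\<close> and stabilizing.\<close>

lemma stable_recurrent_imp_sink_Rec:
  assumes "recurrent G c" and "sink_stable G s (c(s := 0))"
  shows "c(s := 0) \<in> sink_Rec G s"
proof -
  have c: "c \<in> configs G" using assms(1) by (simp add: recurrent_def)
  then obtain M where M: "M \<noteq> {#}" "firing_run G c M c"
    using assms(1) recurrent_iff_cycle by blast
  have "0 < count M s" using firing_cycle_all_verts[OF M(2,1) sink_in_verts] by simp
  moreover have "stab (\<lambda>v. (c(s := 0)) v + count M s * u v) = c(s := 0)"
    using firing_run_project[OF M(2)] assms(2) by (rule stab_eqI)
  moreover have "c(s := 0) \<in> sink_configs G s"
    using c by (auto simp: configs_def sink_configs_def)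
  ultimately show ?thesis using sink_Rec_iff_cycle by blast
qed

section \<open>The \<open>s\<close>-index as a threshold for recurrence\<close>

lemma level_split: "level G c = c s + (\<Sum>v \<in> verts G - {s}. c v)"
  unfolding level_def by (rule sum.remove[OF finite_verts sink_in_verts])

text \<open>With enough chips on \<open>s\<close>, it can fire as often as the period
  \<open>k\<close> of \<open>c\<close> requires. Stabilizing the other vertices then restores
  \<open>c\<close> off the sink, and conservation of chips restores the entry at \<open>s\<close>: a
  sinkless cycle.\<close>

lemma ex_recurrent_add_sink:
  assumes "c \<in> sink_Rec G s"
  shows "\<exists>k. recurrent G (\<lambda>v. c v + k * of_bool (v = s))"
proof -
  obtain k where k: "0 < k" "stab (\<lambda>v. c v + k * u v) = c"
    using assms sink_Rec_iff_cycle by blast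
  let ?b = "\<lambda>m v. c v + m * of_bool (v = s)"
  \<comment> \<open>This many chips let \<open>s\<close> fire \<open>j\<close> times in succession
    without relying on any chip returning to it.\<close>
  have run: "\<exists>d. firing_run G b (replicate_mset j s) d \<and>
      d(s := 0) = (\<lambda>v. (b(s := 0)) v + j * u v)" if "j * out_degree G s \<le> b s" for j b
    using that
  proof (induction j arbitrary: b)
    case 0
    show ?case by (intro exI[of _ b]) (auto intro: firing_run.empty)
  next
    case (Suc j)
    have "j * out_degree G s \<le> fire G s b s" using Suc.prems by (simp add: fire_def)
    then obtain d where d: "firing_run G (fire G s b) (replicate_mset j s) d"
      "d(s := 0) = (\<lambda>v. ((fire G s b)(s := 0)) v + j * u v)" using Suc.IH by blast
    have "firing_run G b (add_mset s (replicate_mset j s)) d"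
      using Suc.prems d(1) sink_in_verts by (intro firing_run.step[of s G b _ d]) auto
    moreover have "d(s := 0) = (\<lambda>v. (b(s := 0)) v + Suc j * u v)"
      unfolding d(2) by (auto simp: fun_eq_iff fire_def sink_arcs_def)
    ultimately show ?case by (intro exI[of _ d]) simp
  qed
  let ?m = "k * out_degree G s"
  have cs: "c s = 0" using sink_RecD[OF assms] by simp
  then have hat: "(?b ?m)(s := 0) = c" by (auto simp: fun_eq_iff)
  have conf: "?b ?m \<in> configs G"
    using sink_RecD(1)[OF assms] sink_in_verts by (auto simp: configs_def sink_configs_def)
  obtain d where d: "firing_run G (?b ?m) (replicate_mset k s) d"
    "d(s := 0) = (\<lambda>v. c v + k * u v)"
    using run[of k "?b ?m"] hat by auto
  obtain e where e: "leads_to G d e" "e(s := 0) = c"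
    using leads_to_lift[OF stab_reach, of d] d(2) k(2) by auto
  then obtain M where M: "firing_run G d M e" by (auto simp: leads_to_iff_firing_run)
  have run': "firing_run G (?b ?m) (replicate_mset k s + M) e"
    using d(1) M by (rule firing_run_trans)
  then have "leads_to G (?b ?m) e" by (auto simp: leads_to_iff_firing_run)
  then have level: "level G e = level G (?b ?m)" using conf by (rule leads_to_configs_level)
  have off_sink: "e v = ?b ?m v" if "v \<noteq> s" for v
    using that fun_cong[OF e(2), of v] by simp
  have "(\<Sum>v \<in> verts G - {s}. e v) = (\<Sum>v \<in> verts G - {s}. ?b ?m v)"
    by (rule sum.cong) (auto simp: off_sink)
  then have "e s = ?b ?m s" using level unfolding level_split by linarith
  with off_sink have "e = ?b ?m" by (intro ext) metis
  with run' have "firing_run G (?b ?m) (replicate_mset k s + M) (?b ?m)" by simp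
  moreover have "replicate_mset k s + M \<noteq> {#}" using k(1) by (cases k) auto
  ultimately have "recurrent G (?b ?m)" using recurrent_iff_cycle[OF conf] by blast
  then show ?thesis by blast
qed

text \<open>Recurrence survives adding chips, so the suitable \<open>k\<close> form an up-set; it is
  nonempty, and \<open>sink_index\<close> is its least element.\<close>

lemma recurrent_add_sink_iff:
  assumes "c \<in> sink_Rec G s"
  shows "recurrent G (\<lambda>v. c v + k * of_bool (v = s)) \<longleftrightarrow> sink_index G s c \<le> k"
proof
  assume "recurrent G (\<lambda>v. c v + k * of_bool (v = s))"
  then show "sink_index G s c \<le> k" unfolding sink_index_def by (rule Least_le)
next
  assume le: "sink_index G s c \<le> k"
  let ?i = "sink_index G s c"
  have "recurrent G (\<lambda>v. c v + ?i * of_bool (v = s))"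
    unfolding sink_index_def using ex_recurrent_add_sink[OF assms] by (rule LeastI_ex)
  then have "recurrent G (\<lambda>v. (c v + ?i * of_bool (v = s)) + (k - ?i) * of_bool (v = s))"
    using sink_in_verts
    by (intro recurrent_add[of "\<lambda>v. c v + ?i * of_bool (v = s)" "\<lambda>v. (k - ?i) * of_bool (v = s)"])
      (auto simp: configs_def)
  moreover have "(\<lambda>v. (c v + ?i * of_bool (v = s)) + (k - ?i) * of_bool (v = s)) =
      (\<lambda>v. c v + k * of_bool (v = s))"
    using le by (auto simp: fun_eq_iff)
  ultimately show "recurrent G (\<lambda>v. c v + k * of_bool (v = s))" by simp
qed

section \<open>Filling up the sink to a given total\<close>

text \<open>This extension of \<open>c\<close> has level \<open>n\<close> if at most
  \<open>n\<close> chips lie off the sink. Otherwise the subtraction truncates, which is why that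
  bound accompanies \<open>fill\<close> below.\<close>

definition fill :: "nat \<Rightarrow> ('a \<Rightarrow> nat) \<Rightarrow> ('a \<Rightarrow> nat)" where
  "fill n c = c(s := n - (\<Sum>v \<in> verts G - {s}. c v))"

lemma fill_eqI:
  assumes "e(s := 0) = c" and "level G e = n"
  shows "fill n c = e" and "(\<Sum>v \<in> verts G - {s}. c v) \<le> n"
proof -
  have "(\<Sum>v \<in> verts G - {s}. c v) = (\<Sum>v \<in> verts G - {s}. e v)"
    using assms(1) by (intro sum.cong) auto
  then show "fill n c = e" "(\<Sum>v \<in> verts G - {s}. c v) \<le> n"
    using assms(2) level_split[of e]
    by (auto simp: fill_def fun_eq_iff simp flip: assms(1))
qed

lemma fill_hat: "c \<in> sink_Rec G s \<Longrightarrow> (fill n c)(s := 0) = c"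
  using sink_RecD(2)[of c] by (auto simp: fill_def fun_eq_iff)

lemma sink_level_le_iff:
  assumes "c \<in> sink_Rec G s"
  shows "sink_level G s c \<le> n \<longleftrightarrow>
    (\<Sum>v \<in> verts G - {s}. c v) \<le> n \<and> recurrent G (fill n c)"
proof -
  let ?m = "\<Sum>v \<in> verts G - {s}. c v"
  have "fill n c = (\<lambda>v. c v + (n - ?m) * of_bool (v = s))"
    using sink_RecD(2)[OF assms] by (auto simp: fill_def fun_eq_iff)
  then have "recurrent G (fill n c) \<longleftrightarrow> sink_index G s c \<le> n - ?m"
    using recurrent_add_sink_iff[OF assms] by simp
  then show ?thesis unfolding sink_level_def by auto
qed

lemma level_fill:
  assumes "(\<Sum>v \<in> verts G - {s}. c v) \<le> n"
  shows "level G (fill n c) = n"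
proof -
  have "(\<Sum>v \<in> verts G - {s}. fill n c v) = (\<Sum>v \<in> verts G - {s}. c v)"
    by (intro sum.cong) (auto simp: fill_def)
  with assms show ?thesis unfolding level_split by (simp add: fill_def)
qed

text \<open>The \<open>j\<close> additions of \<open>u\<close> lift to a sinkless run from
  \<open>fill n c\<close>. Its end agrees with \<open>d\<close> off the sink and has level
  \<open>n\<close>, so it is \<open>fill n d\<close>, and it inherits recurrence.\<close>

lemma sink_rel_imp_leads_to_fill:
  assumes "(c, d) \<in> sink_rel G s" and "sink_level G s c \<le> n"
  shows "sink_level G s d \<le> n" and "leads_to G (fill n c) (fill n d)"
proof -
  obtain j where c: "c \<in> sink_Rec G s" and d: "d \<in> sink_Rec G s"
    and j: "d = stab (\<lambda>v. c v + j * u v)" using assms(1) by (auto simp: sink_rel_def)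
  have rec: "recurrent G (fill n c)" and le: "(\<Sum>v \<in> verts G - {s}. c v) \<le> n"
    using assms(2) sink_level_le_iff[OF c] by auto
  obtain e where e: "leads_to G (fill n c) e" "e(s := 0) = d"
    using recurrent_lift_stab_sink_fires[OF rec, of j] fill_hat[OF c] sink_RecD(3)[OF c] j by auto
  have "fill n c \<in> configs G" using rec by (simp add: recurrent_def)
  then have "level G e = n" using leads_to_configs_level(2)[OF e(1)] level_fill[OF le] by simp
  note fill = fill_eqI[OF e(2) this]
  then show "leads_to G (fill n c) (fill n d)" using e(1) by simp
  show "sink_level G s d \<le> n"
    using sink_level_le_iff[OF d] recurrent_leads_to[OF rec e(1)] fill by simp
qed

text \<open>The number of firings of \<open>s\<close> in the sinkless run serves as the multiple of
  \<open>u\<close>.\<close>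

lemma leads_to_fill_imp_sink_rel:
  assumes "c \<in> sink_Rec G s" and "d \<in> sink_Rec G s" and "leads_to G (fill n c) (fill n d)"
  shows "(c, d) \<in> sink_rel G s"
proof -
  obtain M where "firing_run G (fill n c) M (fill n d)"
    using assms(3) by (auto simp: leads_to_iff_firing_run)
  from firing_run_project[OF this] have "stab (\<lambda>v. c v + count M s * u v) = d"
    using fill_hat[OF assms(1)] fill_hat[OF assms(2)] sink_RecD(3)[OF assms(2)]
    by (intro stab_eqI) auto
  with assms(1,2) show ?thesis unfolding sink_rel_def by blast
qed

lemma sink_level_eq:
  assumes "(c, d) \<in> sink_rel G s"
  shows "sink_level G s d = sink_level G s c"
proof (rule antisym)
  show "sink_level G s d \<le> sink_level G s c"
    using assms order_refl by (rule sink_rel_imp_leads_to_fill)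
  have "(d, c) \<in> sink_rel G s" using equiv_sink_rel assms by (auto simp: equiv_def dest: symD)
  then show "sink_level G s c \<le> sink_level G s d"
    using order_refl by (rule sink_rel_imp_leads_to_fill)
qed

text \<open>Surjectivity on classes: stabilizing \<open>c\<close> off the sink stays in its class
  and ends in a filled \<open>s\<close>-recurrent configuration.\<close>

lemma ex_fill_leads_to:
  assumes "recurrent G c"
  shows "\<exists>d \<in> sink_Rec G s. sink_level G s d \<le> level G c \<and> leads_to G (fill (level G c) d) c"
proof -
  obtain e where e: "leads_to G c e" "e(s := 0) = stab (c(s := 0))"
    using leads_to_lift[OF stab_reach] by blast
  have rec: "recurrent G e" using recurrent_leads_to[OF assms e(1)] .
  have d: "e(s := 0) \<in> sink_Rec G s"
    using stable_recurrent_imp_sink_Rec[OF rec] e(2) stab_stable by simp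
  have "level G e = level G c"
    using leads_to_configs_level(2)[OF e(1)] assms by (simp add: recurrent_def)
  note fill = fill_eqI[OF refl this]
  have "leads_to G e c" using assms e(1) by (simp add: recurrent_def)
  then show ?thesis
    using d fill rec sink_level_le_iff[OF d] by (intro bexI[of _ "e(s := 0)"]) auto
qed

end


section \<open>Counting classes\<close>

text \<open>Equal fibres make the assignment of \<open>g x\<close> to \<open>f x\<close> well
  defined and injective.\<close>

lemma card_image_eq_of_same_fibres:
  assumes "\<And>x y. x \<in> A \<Longrightarrow> y \<in> A \<Longrightarrow> f x = f y \<longleftrightarrow> g x = g y"
  shows "card (f ` A) = card (g ` A)"
proof (rule bij_betw_same_card)
  have inv: "inv_into A f (f x) \<in> A" "f (inv_into A f (f x)) = f x" if "x \<in> A" for x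
    using that by (auto intro: inv_into_into f_inv_into_f)
  then have "g (inv_into A f (f x)) = g x" if "x \<in> A" for x
    using that assms by blast
  then show "bij_betw (\<lambda>z. g (inv_into A f z)) (f ` A) (g ` A)"
    using assms by (auto simp: bij_betw_def inj_on_def image_image)
qed

text \<open>The map induced by \<open>f\<close> on classes is well defined and injective by
  \<open>rel\<close>, and onto by \<open>surj\<close>.\<close>

lemma card_quotient_eq:
  assumes "equiv A r" and "equiv B q" and "A' \<subseteq> A" and "B' \<subseteq> B" and "f ` A' \<subseteq> B'"
    and rel: "\<And>x y. x \<in> A' \<Longrightarrow> y \<in> A' \<Longrightarrow> (x, y) \<in> r \<longleftrightarrow> (f x, f y) \<in> q"
    and surj: "\<And>b. b \<in> B' \<Longrightarrow> \<exists>a \<in> A'. (f a, b) \<in> q"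
  shows "card (A' // r) = card (B' // q)"
proof -
  have "A' // r = (\<lambda>x. r `` {x}) ` A'" by (auto simp: quotient_def)
  moreover have "B' // q = (\<lambda>x. q `` {f x}) ` A'"
  proof (rule set_eqI)
    fix C
    have "\<exists>a \<in> A'. q `` {b} = q `` {f a}" if "b \<in> B'" for b
      using surj[OF that] equiv_class_eq[OF assms(2)] by metis
    then show "C \<in> B' // q \<longleftrightarrow> C \<in> (\<lambda>x. q `` {f x}) ` A'"
      using assms(5) unfolding quotient_def by blast
  qed
  moreover have "r `` {x} = r `` {y} \<longleftrightarrow> q `` {f x} = q `` {f y}" if "x \<in> A'" "y \<in> A'" for x y
    using that assms(3-5) rel eq_equiv_class_iff[OF assms(1), of x y]
      eq_equiv_class_iff[OF assms(2), of "f x" "f y"] by blast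
  ultimately show ?thesis
    using card_image_eq_of_same_fibres[of A' "\<lambda>x. r `` {x}" "\<lambda>x. q `` {f x}"] by simp
qed

text \<open>An invariant condition on a class can be tested at one representative, so it moves from
  the classes to their elements.\<close>

lemma quotient_Collect_invariant:
  assumes "equiv A r" and inv: "\<And>x y. (x, y) \<in> r \<Longrightarrow> P x \<longleftrightarrow> P y"
  shows "{C \<in> A // r. \<forall>x \<in> C. P x} = {x \<in> A. P x} // r"
proof -
  have "(\<forall>y \<in> r `` {x}. P y) \<longleftrightarrow> P x" if "x \<in> A" for x
    using inv equiv_class_self[OF assms(1) that] by blast
  then show ?thesis by (auto simp: quotient_def)
qed

section \<open>Partial sums and the identity of power series\<close>

lemma (in sink_digraph) card_rec_classes:
  "card (rec_classes G n) = (\<Sum>m\<le>n. card (sink_classes G s m))"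
proof -
  let ?A = "{c \<in> sink_Rec G s. sink_level G s c \<le> n}" and ?B = "{c \<in> Rec G. level G c = n}"
  have "(\<Union>m\<le>n. sink_classes G s m) = ?A // sink_rel G s"
  proof -
    have "sink_classes G s m = {c \<in> sink_Rec G s. sink_level G s c = m} // sink_rel G s" for m
      unfolding sink_classes_def using sink_level_eq
      by (intro quotient_Collect_invariant[OF equiv_sink_rel]) auto
    then show ?thesis by (auto simp: quotient_def)
  qed
  moreover have "rec_classes G n = ?B // rec_rel G"
    unfolding rec_classes_def
  proof (rule quotient_Collect_invariant[OF equiv_rec_rel])
    fix c d assume "(c, d) \<in> rec_rel G"
    then have "leads_to G c d" "c \<in> configs G"
      by (auto simp: rec_rel_def Rec_def recurrent_def)
    then have "level G d = level G c" by (rule leads_to_configs_level)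
    then show "level G c = n \<longleftrightarrow> level G d = n" by simp
  qed
  moreover have "card (?A // sink_rel G s) = card (?B // rec_rel G)"
  proof (rule card_quotient_eq[OF equiv_sink_rel equiv_rec_rel, where f = "fill n"])
    show fill: "fill n ` ?A \<subseteq> ?B"
      using sink_level_le_iff level_fill by (auto simp: Rec_def)
    show "(c, d) \<in> sink_rel G s \<longleftrightarrow> (fill n c, fill n d) \<in> rec_rel G"
      if "c \<in> ?A" "d \<in> ?A" for c d
    proof -
      have "fill n c \<in> Rec G" "fill n d \<in> Rec G" using that fill by auto
      then show ?thesis
        using that sink_rel_imp_leads_to_fill(2)[of c d n] leads_to_fill_imp_sink_rel[of c d n]
        by (auto simp: rec_rel_def)
    qed
    show "\<exists>d \<in> ?A. (fill n d, c) \<in> rec_rel G" if c: "c \<in> ?B" for c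
    proof -
      obtain d where "d \<in> ?A" "leads_to G (fill n d) c"
        using c ex_fill_leads_to[of c] by (auto simp: Rec_def)
      then show ?thesis using c fill by (auto simp: rec_rel_def)
    qed
  qed auto
  moreover have "card (\<Union>m\<le>n. sink_classes G s m) = (\<Sum>m\<le>n. card (sink_classes G s m))"
  proof (rule card_UN_disjoint)
    have "sink_classes G s m \<subseteq> Pow (sink_Rec G s)" for m
      using equiv_sink_rel by (auto simp: sink_classes_def quotient_def sink_rel_def)
    then show "\<forall>m\<in>{..n}. finite (sink_classes G s m)"
      using finite_sink_Rec[OF fin_digraph_axioms strong sink_in_verts]
      by (auto intro: finite_subset)
    \<comment> \<open>An empty class would satisfy the level condition vacuously for every level;
      nonemptiness gives disjointness.\<close>
    have "C \<noteq> {}" if "C \<in> sink_classes G s m" for C m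
      using that in_quotient_imp_non_empty[OF equiv_sink_rel] by (auto simp: sink_classes_def)
    then show "\<forall>i\<in>{..n}. \<forall>j\<in>{..n}. i \<noteq> j \<longrightarrow> sink_classes G s i \<inter> sink_classes G s j = {}"
      by (fastforce simp: sink_classes_def)
  qed simp
  ultimately show ?thesis by simp
qed

text \<open>Multiplying by \<open>1 - fps_X\<close> takes successive differences of coefficients,
  which undoes the partial sums.\<close>

lemma (in sink_digraph) rec_series_mult: "rec_series G * (1 - fps_X) = sink_series G s"
proof (rule fps_ext)
  fix n
  show "fps_nth (rec_series G * (1 - fps_X)) n = fps_nth (sink_series G s) n"
    by (cases n) (simp_all add: right_diff_distrib rec_series_def sink_series_def card_rec_classes)
qed

theorem theorem4p1:
  fixes G :: "('a, 'b) pre_digraph"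
  assumes "fin_digraph G"
    and "strongly_connected G"
  shows "(\<forall>s \<in> verts G. rec_series G = sink_series G s / (1 - fps_X)) \<and>
         (\<forall>s \<in> verts G. \<forall>t \<in> verts G. sink_series G s = sink_series G t)"
proof -
  have *: "sink_series G s = rec_series G * (1 - fps_X)" if "s \<in> verts G" for s
  proof -
    interpret fin_digraph G by fact
    interpret sink_digraph G s using assms(2) that by unfold_locales auto
    show ?thesis using rec_series_mult by simp
  qed
  have "(1 - fps_X :: rat fps) \<noteq> 0"
    by (auto simp: fps_eq_iff intro!: exI[of _ 0])
  then have "rec_series G = sink_series G s / (1 - fps_X)" if "s \<in> verts G" for s
    using *[OF that] by simp
  \<comment> \<open>By \<open>*\<close> all sink series equal one product that does not involve the
    sink.\<close>
  then show ?thesis using * by simp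
qed

end
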